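(* Let $G$ be a cubic claw-free graph. Then $\gamma(G)\leq \gamma_e(G)$.
   Context: All graphs are finite, simple, and undirected. A graph is cubic if it is $3$-regular, that is, every vertex has exactly $3$ neighbors. A graph is claw-free if it has no induced subgraph isomorphic to the claw $K_{1,3}$, that is, no vertex has three pairwise non-adjacent neighbors. A set $D\subseteq V(G)$ is a dominating set in $G$ if every vertex in $V(G)\setminus D$ has a neighbor in $D$; the domination number $\gamma(G)$ is the minimum cardinality of a dominating set in $G$. A matching in $G$ is a set of pairwise disjoint edges of $G$; it is maximal if it is maximal with respect to inclusion among matchings in $G$ (equivalently, the set of vertices not incident with any edge of the matching is independent). The edge domination number $\gamma_e(G)$ is the minimum size (number of edges) of a maximal matching in $G$. *)

theory Defs
  imports Main
begin

text \<open>A graph is given by a vertex set \<open>V\<close> and a set \<open>E\<close> of two-element subsets of \<open>V\<close>.\<close>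

definition simple_graph :: "'a set \<Rightarrow> 'a set set \<Rightarrow> bool" where
  "simple_graph V E \<longleftrightarrow> finite V \<and> (\<forall>e\<in>E. e \<subseteq> V \<and> card e = 2)"

definition neighbors :: "'a set \<Rightarrow> 'a set set \<Rightarrow> 'a \<Rightarrow> 'a set" where
  "neighbors V E v = {u \<in> V. {u, v} \<in> E}"

definition cubic :: "'a set \<Rightarrow> 'a set set \<Rightarrow> bool" where
  "cubic V E \<longleftrightarrow> (\<forall>v\<in>V. card (neighbors V E v) = 3)"

definition induced_edges :: "'a set set \<Rightarrow> 'a set \<Rightarrow> 'a set set" where
  "induced_edges E S = {e \<in> E. e \<subseteq> S}"

definition graph_isomorphic ::
    "'a set \<Rightarrow> 'a set set \<Rightarrow> 'b set \<Rightarrow> 'b set set \<Rightarrow> bool" where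
  "graph_isomorphic V E V' E' \<longleftrightarrow>
     (\<exists>f. bij_betw f V V' \<and> (\<forall>u\<in>V. \<forall>v\<in>V. {u, v} \<in> E \<longleftrightarrow> {f u, f v} \<in> E'))"

definition claw_verts :: "nat set" where
  "claw_verts = {0, 1, 2, 3}"

definition claw_edges :: "nat set set" where
  "claw_edges = {{0, 1}, {0, 2}, {0, 3}}"

definition claw_free :: "'a set \<Rightarrow> 'a set set \<Rightarrow> bool" where
  "claw_free V E \<longleftrightarrow>
     \<not> (\<exists>S\<subseteq>V. graph_isomorphic S (induced_edges E S) claw_verts claw_edges)"

definition dominating_set :: "'a set \<Rightarrow> 'a set set \<Rightarrow> 'a set \<Rightarrow> bool" where
  "dominating_set V E D \<longleftrightarrow> D \<subseteq> V \<and> (\<forall>v\<in>V - D. \<exists>u\<in>D. {u, v} \<in> E)"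

definition domination_number :: "'a set \<Rightarrow> 'a set set \<Rightarrow> nat" where
  "domination_number V E = Min (card ` {D. dominating_set V E D})"

definition matching :: "'a set set \<Rightarrow> 'a set set \<Rightarrow> bool" where
  "matching E M \<longleftrightarrow> M \<subseteq> E \<and> pairwise disjnt M"

definition maximal_matching :: "'a set set \<Rightarrow> 'a set set \<Rightarrow> bool" where
  "maximal_matching E M \<longleftrightarrow>
     matching E M \<and> (\<forall>M'. matching E M' \<and> M \<subseteq> M' \<longrightarrow> M' = M)"

definition edge_domination_number :: "'a set set \<Rightarrow> nat" where
  "edge_domination_number E = Min (card ` {M. maximal_matching E M})"

text \<open>The sets whose minima are taken above are finite and nonempty for every simple graph.\<close>

lemma finite_edges:
  assumes "simple_graph V E"
  shows "finite E"
proof -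
  have "E \<subseteq> Pow V" and "finite V"
    using assms by (auto simp: simple_graph_def)
  then show ?thesis
    by (meson finite_Pow_iff finite_subset)
qed

lemma dominating_sets_finite_nonempty:
  assumes "simple_graph V E"
  shows "finite {D. dominating_set V E D}" and "{D. dominating_set V E D} \<noteq> {}"
proof -
  have "{D. dominating_set V E D} \<subseteq> Pow V" and "finite V"
    using assms by (auto simp: simple_graph_def dominating_set_def)
  then show "finite {D. dominating_set V E D}"
    by (meson finite_Pow_iff finite_subset)
  have "dominating_set V E V"
    by (simp add: dominating_set_def)
  then show "{D. dominating_set V E D} \<noteq> {}"
    by blast
qed

lemma maximal_matchings_finite_nonempty:
  assumes "simple_graph V E"
  shows "finite {M. maximal_matching E M}" and "{M. maximal_matching E M} \<noteq> {}"
proof -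
  have fin: "finite (Pow E)"
    using finite_edges[OF assms] by simp
  have "{M. maximal_matching E M} \<subseteq> Pow E"
    by (auto simp: maximal_matching_def matching_def)
  then show "finite {M. maximal_matching E M}"
    using fin by (rule finite_subset)
  have "{M. matching E M} \<subseteq> Pow E"
    by (auto simp: matching_def)
  then have "finite {M. matching E M}"
    using fin by (rule finite_subset)
  moreover have "{} \<in> {M. matching E M}"
    by (simp add: matching_def)
  ultimately obtain M where "M \<in> {M. matching E M}"
    and "\<forall>M'\<in>{M. matching E M}. M \<subseteq> M' \<longrightarrow> M = M'"
    using finite_has_maximal[of "{M. matching E M}"] by blast
  then have "maximal_matching E M"
    by (auto simp: maximal_matching_def)
  then show "{M. maximal_matching E M} \<noteq> {}"
    by blast
qed

lemma claw_free_iff: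
  assumes "simple_graph V E"
  shows "claw_free V E \<longleftrightarrow>
    \<not> (\<exists>v\<in>V. \<exists>a\<in>neighbors V E v. \<exists>b\<in>neighbors V E v. \<exists>c\<in>neighbors V E v.
         distinct [a, b, c] \<and> {a, b} \<notin> E \<and> {a, c} \<notin> E \<and> {b, c} \<notin> E)"
    (is "_ \<longleftrightarrow> \<not> ?claw")
proof -
  have no_loop: "{x} \<notin> E" for x
    using assms by (force simp: simple_graph_def)
  have "(\<exists>S\<subseteq>V. graph_isomorphic S (induced_edges E S) claw_verts claw_edges) \<longleftrightarrow> ?claw"
  proof
    assume "\<exists>S\<subseteq>V. graph_isomorphic S (induced_edges E S) claw_verts claw_edges"
    then obtain S f where S: "S \<subseteq> V" and f: "bij_betw f S claw_verts"
      and adj: "\<And>u v. u \<in> S \<Longrightarrow> v \<in> S \<Longrightarrow> {u, v} \<in> E \<longleftrightarrow> {f u, f v} \<in> claw_edges"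
      by (auto simp: graph_isomorphic_def induced_edges_def)
    define g where "g = inv_into S f"
    have g: "g i \<in> S" "f (g i) = i" if "i \<in> claw_verts" for i
      using that f by (auto simp: g_def bij_betw_def inv_into_into f_inv_into_f)
    have gadj: "{g i, g j} \<in> E \<longleftrightarrow> {i, j} \<in> claw_edges"
      if "i \<in> claw_verts" "j \<in> claw_verts" for i j
      using adj[OF g(1)[OF that(1)] g(1)[OF that(2)]] g(2)[OF that(1)] g(2)[OF that(2)] by (simp only:)
    have cv: "(0::nat) \<in> claw_verts" "(1::nat) \<in> claw_verts"
      "(2::nat) \<in> claw_verts" "(3::nat) \<in> claw_verts"
      by (simp_all add: claw_verts_def)
    have ne: "g i \<noteq> g j" if "i \<in> claw_verts" "j \<in> claw_verts" "i \<noteq> j" for i j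
      using g(2)[OF that(1)] g(2)[OF that(2)] that(3) by metis
    have nb: "g i \<in> neighbors V E (g 0)" if "i \<in> {1, 2, 3}" for i
      using that gadj[of i 0] g(1)[of i] S
      by (auto simp: neighbors_def claw_verts_def claw_edges_def doubleton_eq_iff)
    have "{g 1, g 2} \<notin> E" "{g 1, g 3} \<notin> E" "{g 2, g 3} \<notin> E"
      unfolding gadj[OF cv(2) cv(3)] gadj[OF cv(2) cv(4)] gadj[OF cv(3) cv(4)]
      by (simp_all add: claw_edges_def doubleton_eq_iff)
    moreover have "distinct [g 1, g 2, g 3]"
      using ne[OF cv(2) cv(3)] ne[OF cv(2) cv(4)] ne[OF cv(3) cv(4)] by simp
    moreover have "g 0 \<in> V"
      using g(1)[OF cv(1)] S by blast
    moreover have "g 1 \<in> neighbors V E (g 0)" "g 2 \<in> neighbors V E (g 0)"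
      "g 3 \<in> neighbors V E (g 0)"
      by (intro nb; simp)+
    ultimately show ?claw
      by blast
  next
    assume ?claw
    then obtain v a b c where v: "v \<in> V"
      and nb: "a \<in> neighbors V E v" "b \<in> neighbors V E v" "c \<in> neighbors V E v"
      and d: "a \<noteq> b" "a \<noteq> c" "b \<noteq> c"
      and na: "{a, b} \<notin> E" "{a, c} \<notin> E" "{b, c} \<notin> E"
      by auto
    have V: "a \<in> V" "b \<in> V" "c \<in> V" and e: "{a, v} \<in> E" "{b, v} \<in> E" "{c, v} \<in> E"
      using nb by (auto simp: neighbors_def)
    have e': "{v, a} \<in> E" "{v, b} \<in> E" "{v, c} \<in> E"
      using e by (simp_all add: insert_commute)
    have na': "{b, a} \<notin> E" "{c, a} \<notin> E" "{c, b} \<notin> E"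
      using na by (simp_all add: insert_commute)
    have vd: "v \<noteq> a" "v \<noteq> b" "v \<noteq> c"
      using e no_loop by auto
    define f :: "_ \<Rightarrow> nat" where
      "f = (\<lambda>x. if x = v then 0 else if x = a then 1 else if x = b then 2 else 3)"
    have fv: "f v = 0" "f a = 1" "f b = 2" "f c = 3"
      using d vd by (auto simp: f_def)
    have "bij_betw f {v, a, b, c} claw_verts"
    proof (rule bij_betw_imageI)
      show "inj_on f {v, a, b, c}"
        by (rule inj_onI, elim insertE emptyE) (simp_all add: fv)
      show "f ` {v, a, b, c} = claw_verts"
        by (simp add: fv claw_verts_def)
    qed
    moreover have "\<forall>x\<in>{v, a, b, c}. \<forall>y\<in>{v, a, b, c}.
        {x, y} \<in> induced_edges E {v, a, b, c} \<longleftrightarrow> {f x, f y} \<in> claw_edges"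
      by (intro ballI, elim insertE emptyE)
        (simp_all add: fv e e' na na' no_loop induced_edges_def claw_edges_def doubleton_eq_iff)
    ultimately show "\<exists>S\<subseteq>V. graph_isomorphic S (induced_edges E S) claw_verts claw_edges"
      unfolding graph_isomorphic_def using v V
      by (intro exI[of _ "{v, a, b, c}"] conjI exI[of _ f]) simp_all
  qed
  then show ?thesis
    by (simp add: claw_free_def)
qed

end

theory Submission
  imports Defs
begin

text \<open>Any choice of one endpoint from each edge of a maximal matching \<open>M\<close> dominates the covered
  vertices and every uncovered vertex that is adjacent to both ends of some edge of \<open>M\<close>. All three
  neighbors of any other uncovered vertex are covered, and by claw-freeness no vertex is adjacent
  to two such uncovered vertices. Hence \<open>k\<close> of them meet at least \<open>3 * k / 2\<close> edges of \<open>M\<close>, and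
  Hall's theorem assigns them distinct edges, from each of which the suitable endpoint is chosen.\<close>

text \<open>Halmos-Vaughan induction on \<open>card I\<close>. Either some nonempty proper subfamily
  is tight, and the family splits into it and the rest, or every nonempty proper subfamily has a
  spare element, so one value may be fixed freely.\<close>

theorem hall_marriage:
  assumes "finite I"
    and "\<And>i. i \<in> I \<Longrightarrow> finite (A i)"
    and "\<And>J. J \<subseteq> I \<Longrightarrow> card J \<le> card (\<Union>i\<in>J. A i)"
  shows "\<exists>f. inj_on f I \<and> (\<forall>i\<in>I. f i \<in> A i)"
  using assms
proof (induction "card I" arbitrary: I A rule: less_induct)
  case less
  note fin = less.prems(1) and finA = less.prems(2) and hall = less.prems(3)
  show ?case
  proof (cases "\<exists>J. J \<subset> I \<and> J \<noteq> {} \<and> card J = card (\<Union>i\<in>J. A i)")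
    case True
    then obtain J where J: "J \<subset> I" "J \<noteq> {}" "card J = card (\<Union>i\<in>J. A i)"
      by blast
    define N where "N = (\<Union>i\<in>J. A i)"
    have finJ: "finite J" using J(1) fin finite_subset by blast
    have finN: "finite N" using J(1) finA finJ by (auto simp: N_def)
    have "\<exists>f. inj_on f J \<and> (\<forall>i\<in>J. f i \<in> A i)"
    proof (rule less.hyps)
      show "card J < card I" using J(1) fin by (rule psubset_card_mono[rotated])
      show "finite (A i)" if "i \<in> J" for i using that J(1) finA by blast
      show "card K \<le> card (\<Union>i\<in>K. A i)" if "K \<subseteq> J" for K
        using hall[of K] that J(1) by blast
    qed (rule finJ)
    then obtain f where f: "inj_on f J" "\<forall>i\<in>J. f i \<in> A i" by blast
    \<comment> \<open>The tight part \<open>J\<close> uses up \<open>N\<close>, so the rest must be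
      matched outside \<open>N\<close>. Hall's condition survives there: apply it to
      \<open>K \<union> J\<close> and cancel \<open>card N = card J\<close>.\<close>
    have "\<exists>g. inj_on g (I - J) \<and> (\<forall>i\<in>I - J. g i \<in> A i - N)"
    proof (rule less.hyps)
      show "card (I - J) < card I"
        using J(1,2) fin by (intro psubset_card_mono) auto
      show "finite (A i - N)" if "i \<in> I - J" for i using that finA by blast
      show "card K \<le> card (\<Union>i\<in>K. A i - N)" if K: "K \<subseteq> I - J" for K
      proof -
        have finK: "finite K" using K fin by (meson finite_Diff finite_subset)
        have "card K + card J = card (K \<union> J)"
          using finK finJ K by (subst card_Un_disjoint) auto
        also have "\<dots> \<le> card (\<Union>i\<in>K \<union> J. A i)"
          using K J(1) by (intro hall) blast
        also have "(\<Union>i\<in>K \<union> J. A i) = (\<Union>i\<in>K. A i - N) \<union> N"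
          by (auto simp: N_def)
        also have "card \<dots> \<le> card (\<Union>i\<in>K. A i - N) + card N"
          by (rule card_Un_le)
        finally show ?thesis using J(3) by (simp add: N_def)
      qed
    qed (use fin in simp)
    then obtain g where g: "inj_on g (I - J)" "\<forall>i\<in>I - J. g i \<in> A i - N" by blast
    have fg: "f i \<noteq> g j" if "i \<in> J" "j \<in> I - J" for i j
      using f(2) g(2) that by (force simp: N_def)
    let ?h = "\<lambda>i. if i \<in> J then f i else g i"
    have "inj_on ?h I"
    proof (rule inj_onI)
      fix i j assume ij: "i \<in> I" "j \<in> I" "?h i = ?h j"
      then show "i = j"
        using f(1) g(1) fg[of i j] fg[of j i]
        by (cases "i \<in> J"; cases "j \<in> J") (auto dest: inj_onD)
    qed
    moreover have "\<forall>i\<in>I. ?h i \<in> A i" using f(2) g(2) by auto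
    ultimately show ?thesis by (intro exI[of _ ?h] conjI)
  next
    case False
    show ?thesis
    proof (cases "I = {}")
      case True
      then show ?thesis by simp
    next
      case ne: False
      then obtain i where i: "i \<in> I" by blast
      have "A i \<noteq> {}" using hall[of "{i}"] i by auto
      then obtain x where x: "x \<in> A i" by blast
      have "\<exists>g. inj_on g (I - {i}) \<and> (\<forall>j\<in>I - {i}. g j \<in> A j - {x})"
      proof (rule less.hyps)
        show "card (I - {i}) < card I" using i fin by (rule card_Diff1_less[rotated])
        show "finite (A j - {x})" if "j \<in> I - {i}" for j using that finA by blast
        show "card K \<le> card (\<Union>j\<in>K. A j - {x})" if K: "K \<subseteq> I - {i}" for K
        proof (cases "K = {}")
          case Kne: False
          have sub: "K \<subset> I" using K i by blast
          \<comment> \<open>Without tight proper subfamilies the inequality for \<open>K\<close> is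
            strict, which pays for the loss of the single element \<open>x\<close>.\<close>
          have "card K \<noteq> card (\<Union>j\<in>K. A j)" using False sub Kne by blast
          then have "card K < card (\<Union>j\<in>K. A j)" using hall[of K] sub by auto
          moreover have "(\<Union>j\<in>K. A j - {x}) = (\<Union>j\<in>K. A j) - {x}" by blast
          ultimately show ?thesis by (auto simp: card_Diff_singleton_if)
        qed simp
      qed (use fin in simp)
      then obtain g where g: "inj_on g (I - {i})" "\<forall>j\<in>I - {i}. g j \<in> A j - {x}" by blast
      let ?h = "g(i := x)"
      have "inj_on ?h I"
      proof (rule inj_onI)
        fix j k assume "j \<in> I" "k \<in> I" "?h j = ?h k"
        then show "j = k"
          using g by (cases "j = i"; cases "k = i") (auto dest: inj_onD)
      qed
      moreover have "\<forall>j\<in>I. ?h j \<in> A j" using g(2) x by auto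
      ultimately show ?thesis by (intro exI[of _ ?h] conjI)
    qed
  qed
qed

text \<open>Otherwise the edge could be added to \<open>M\<close>.\<close>

lemma maximal_matching_covers:
  assumes "maximal_matching E M" and "{u, v} \<in> E"
  shows "u \<in> \<Union>M \<or> v \<in> \<Union>M"
proof (rule ccontr)
  assume unc: "\<not> (u \<in> \<Union>M \<or> v \<in> \<Union>M)"
  have "matching E (insert {u, v} M)"
    using assms unc
    by (auto simp: maximal_matching_def matching_def pairwise_insert disjnt_def)
  then have "insert {u, v} M = M"
    using assms(1) unfolding maximal_matching_def by blast
  then show False using unc by blast
qed

lemma maximal_matching_dominating_set:
  assumes G: "simple_graph V E" and cub: "cubic V E" and claw: "claw_free V E"
    and M: "maximal_matching E M"
  shows "\<exists>D. dominating_set V E D \<and> card D \<le> card M"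
proof -
  let ?N = "neighbors V E"
  have finV: "finite V" using G by (simp add: simple_graph_def)
  have ME: "M \<subseteq> E" using M by (simp add: maximal_matching_def matching_def)
  then have finM: "finite M" using finite_edges[OF G] finite_subset by blast
  have edge: "e \<subseteq> V" "card e = 2" if "e \<in> M" for e
    using that ME G by (auto simp: simple_graph_def)
  \<comment> \<open>\<open>B\<close> collects the vertices that a careless choice of endpoints might
    leave undominated; \<open>A u\<close> consists of the edges of \<open>M\<close> with an endpoint
    that would dominate \<open>u\<close>.\<close>
  define B where "B = {u \<in> V - \<Union>M. \<not> (\<exists>e\<in>M. e \<subseteq> ?N u)}"
  define A where "A u = {e \<in> M. e \<inter> ?N u \<noteq> {}}" for u
  have covered: "x \<in> \<Union>M" if "u \<in> B" "x \<in> ?N u" for u x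
    using that maximal_matching_covers[OF M, of x u] by (auto simp: B_def neighbors_def)
  have disj: "?N u \<inter> ?N w = {}" if uw: "u \<in> B" "w \<in> B" "u \<noteq> w" for u w
  proof (rule ccontr)
    assume "?N u \<inter> ?N w \<noteq> {}"
    then obtain x where x: "x \<in> ?N u" "x \<in> ?N w" by blast
    obtain e where e: "e \<in> M" "x \<in> e" using covered[OF uw(1) x(1)] by blast
    \<comment> \<open>The claw is centered at \<open>x\<close> with leaves \<open>u\<close>,
      \<open>w\<close> and its partner \<open>y\<close>: \<open>u\<close> and \<open>w\<close> are
      both uncovered, hence nonadjacent, and if \<open>y\<close> were adjacent to one of them,
      \<open>e\<close> would lie in the neighborhood of that vertex, contrary to the definition of
      \<open>B\<close>.\<close>
    obtain y where y: "e = {x, y}" "y \<noteq> x"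
      using edge(2)[OF e(1)] e(2) by (auto simp: card_2_iff)
    have nb: "u \<in> ?N x" "w \<in> ?N x" "y \<in> ?N x"
      using x uw e y ME edge(1)[OF e(1)]
      by (auto simp: neighbors_def B_def insert_commute)
    have ne: "u \<noteq> y" "w \<noteq> y" using uw e(1) y(1) by (auto simp: B_def)
    have "{u, w} \<notin> E"
      using uw maximal_matching_covers[OF M, of u w] by (auto simp: B_def)
    moreover have "{u, y} \<notin> E" "{w, y} \<notin> E"
      using uw x e y edge(1)[OF e(1)] by (auto simp: B_def neighbors_def insert_commute)
    moreover have "x \<in> V" using x by (simp add: neighbors_def)
    ultimately show False
      using claw nb ne uw(3) unfolding claw_free_iff[OF G] by auto
  qed
  have hall: "card J \<le> card (\<Union>u\<in>J. A u)" if J: "J \<subseteq> B" for J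
  proof -
    have finJ: "finite J" using J finV by (auto simp: B_def intro: finite_subset)
    have AM: "(\<Union>u\<in>J. A u) \<subseteq> M" by (auto simp: A_def)
    have finA: "finite (\<Union>u\<in>J. A u)" using AM finM finite_subset by blast
    have finU: "finite (\<Union>(\<Union>u\<in>J. A u))"
      using AM edge(1) finV by (intro finite_subset[OF _ finV]) blast
    \<comment> \<open>Double counting: the disjoint neighborhoods hold \<open>3 * card J\<close>
      vertices, all lying on the edges in question, and each edge has two ends.\<close>
    have "3 * card J = (\<Sum>u\<in>J. card (?N u))"
      using J cub by (simp add: cubic_def B_def subset_iff)
    also have "\<dots> = card (\<Union>u\<in>J. ?N u)"
      using finJ J disj finV by (intro card_UN_disjoint[symmetric]) (auto simp: neighbors_def)
    also have "\<dots> \<le> card (\<Union>(\<Union>u\<in>J. A u))"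
    proof (rule card_mono[OF finU], rule subsetI)
      fix x assume "x \<in> (\<Union>u\<in>J. ?N u)"
      then obtain u where u: "u \<in> J" "x \<in> ?N u" by blast
      then obtain e where "e \<in> M" "x \<in> e" using covered J by blast
      then show "x \<in> \<Union>(\<Union>u\<in>J. A u)" using u by (auto simp: A_def)
    qed
    also have "\<dots> \<le> (\<Sum>e\<in>(\<Union>u\<in>J. A u). card e)"
      by (rule card_Union_le_sum_card)
    also have "\<dots> = 2 * card (\<Union>u\<in>J. A u)"
      using AM edge(2) by (simp add: subset_iff)
    finally show ?thesis by linarith
  qed
  have "\<exists>f. inj_on f B \<and> (\<forall>u\<in>B. f u \<in> A u)"
    using finV finM hall by (intro hall_marriage) (auto simp: A_def B_def)
  then obtain f where f: "inj_on f B" "\<And>u. u \<in> B \<Longrightarrow> f u \<in> A u" by blast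
  \<comment> \<open>As \<open>f\<close> is injective, at most one vertex of \<open>B\<close> makes a
    demand on \<open>e\<close>; if none does, either endpoint serves.\<close>
  have "\<exists>x. x \<in> e \<and> (\<forall>u\<in>B. f u = e \<longrightarrow> x \<in> ?N u)" if e: "e \<in> M" for e
  proof (cases "\<exists>u\<in>B. f u = e")
    case True
    then obtain u where u: "u \<in> B" "f u = e" by blast
    then obtain x where "x \<in> e" "x \<in> ?N u" using f(2)[of u] by (auto simp: A_def)
    then show ?thesis using u f(1) by (metis inj_onD)
  next
    case False
    have "e \<noteq> {}" using edge(2)[OF e] by auto
    then show ?thesis using False by blast
  qed
  then obtain c where c: "\<And>e. e \<in> M \<Longrightarrow> c e \<in> e"
    "\<And>e u. e \<in> M \<Longrightarrow> u \<in> B \<Longrightarrow> f u = e \<Longrightarrow> c e \<in> ?N u"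
    by metis
  \<comment> \<open>A covered \<open>v\<close> is dominated by its partner, which was chosen in its
    place; a vertex of \<open>B\<close> by the endpoint chosen from \<open>f v\<close>; any other
    uncovered vertex by whichever end was chosen of an edge inside its neighborhood.\<close>
  have "\<exists>x\<in>c ` M. {x, v} \<in> E" if v: "v \<in> V - c ` M" for v
  proof (cases "v \<in> \<Union>M")
    case True
    then obtain e where e: "e \<in> M" "v \<in> e" by blast
    have "c e \<noteq> v" using v e(1) by blast
    then have "e = {c e, v}" using edge(2)[OF e(1)] c(1)[OF e(1)] e(2) by (auto simp: card_2_iff)
    then show ?thesis using e(1) ME by (metis imageI subsetD)
  next
    case unc: False
    show ?thesis
    proof (cases "v \<in> B")
      case True
      then have "f v \<in> M" using f(2) by (auto simp: A_def)
      then show ?thesis using c(2) True by (auto simp: neighbors_def)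
    next
      case False
      then obtain e where "e \<in> M" "e \<subseteq> ?N v" using v unc by (auto simp: B_def)
      then show ?thesis using c(1) by (auto simp: neighbors_def)
    qed
  qed
  moreover have "c ` M \<subseteq> V" using c(1) edge(1) by blast
  ultimately have "dominating_set V E (c ` M)" by (simp add: dominating_set_def)
  then show ?thesis using card_image_le[OF finM] by blast
qed

theorem theorem3:
  fixes V :: "'a set" and E :: "'a set set"
  assumes "simple_graph V E"
    and "cubic V E"
    and "claw_free V E"
  shows "domination_number V E \<le> edge_domination_number E"
proof -
  \<comment> \<open>The minimum is attained, so the bound can be applied to a smallest maximal
    matching.\<close>
  have "edge_domination_number E \<in> card ` {M. maximal_matching E M}"
    unfolding edge_domination_number_def
    using maximal_matchings_finite_nonempty[OF assms(1)] by (intro Min_in) auto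
  then obtain M where M: "maximal_matching E M" "edge_domination_number E = card M"
    by blast
  obtain D where D: "dominating_set V E D" "card D \<le> card M"
    using maximal_matching_dominating_set[OF assms M(1)] by blast
  have "domination_number V E \<le> card D"
    unfolding domination_number_def
    using dominating_sets_finite_nonempty(1)[OF assms(1)] D(1) by (intro Min_le) auto
  then show ?thesis using D(2) M(2) by linarith
qed

end
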